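(* Let $p$ be a prime and let $G$ be a non-trivial $p$-group with set of minimal subgroups $\Omega_G=\{H_i\}_{i\in I}$, such that $H_iH_j=H_jH_i$ for all $H_i,H_j\in\Omega_G$ and $|\Omega_G|\ge2$. Let $H_r\in\Omega_G$. Then $\Gamma(H_r)$ is an empty graph (that is, it has no edges) when $|\Omega(G)|=p^2$, and $\Gamma(H_r)$ is connected when $|\Omega(G)|>p^2$.
   Context: Minimal subgroup means minimal non-trivial subgroup. $\Gamma(H_r)$ is the simple graph with vertex set $V_{H_r}=\Omega_G\setminus\{H_r\}$ and edge set $E_{H_r}=\{(H_i,H_j)\mid H_i\ne H_j,\ H_iH_j\cap H_r=1\}$ (with $H_i,H_j\in V_{H_r}$). For a $p$-group $G$, $\Omega(G)=\Omega_p(G)=\langle x\in G\mid x^p=1\rangle$ is the subgroup generated by all minimal subgroups of $G$. Groups may be infinite; a $p$-group is a group in which every element has order a power of $p$. *)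

theory Defs
  imports
    "HOL-Algebra.Multiplicative_Group"
    "HOL-Algebra.Generated_Groups"
    "HOL-Computational_Algebra.Primes"
    "Graph_Theory.Graph_Theory"
begin

text \<open>Infinite groups are allowed. Since \<open>group.ord\<close> is \<open>0\<close> on elements of infinite order, the
  condition below excludes such elements when \<open>p\<close> is prime.\<close>

definition p_group :: "nat \<Rightarrow> ('a, 'b) monoid_scheme \<Rightarrow> bool" where
  "p_group p G \<longleftrightarrow> group G \<and> (\<forall>x\<in>carrier G. \<exists>n::nat. group.ord G x = p ^ n)"

definition minimal_subgroup :: "'a set \<Rightarrow> ('a, 'b) monoid_scheme \<Rightarrow> bool" where
  "minimal_subgroup H G \<longleftrightarrow>
     subgroup H G \<and> H \<noteq> {\<one>\<^bsub>G\<^esub>} \<and>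
     (\<forall>K. subgroup K G \<and> K \<noteq> {\<one>\<^bsub>G\<^esub>} \<and> K \<subseteq> H \<longrightarrow> K = H)"

definition minimal_subgroups :: "('a, 'b) monoid_scheme \<Rightarrow> 'a set set" where
  "minimal_subgroups G = {H. minimal_subgroup H G}"

definition Omega :: "nat \<Rightarrow> ('a, 'b) monoid_scheme \<Rightarrow> 'a set" where
  "Omega p G = generate G {x \<in> carrier G. x [^]\<^bsub>G\<^esub> p = \<one>\<^bsub>G\<^esub>}"

text \<open>An undirected edge is represented by its two opposite arcs. The arc relation is symmetric and
  irreflexive by \<open>Gamma_simple\<close> below, so this is a simple graph. The vertex set may be infinite.\<close>

definition Gamma :: "('a, 'b) monoid_scheme \<Rightarrow> 'a set \<Rightarrow> 'a set pair_pre_digraph" where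
  "Gamma G R =
     \<lparr> pverts = minimal_subgroups G - {R},
       parcs = {(H, K). H \<in> minimal_subgroups G - {R} \<and> K \<in> minimal_subgroups G - {R} \<and>
                        H \<noteq> K \<and> (H <#>\<^bsub>G\<^esub> K) \<inter> R = {\<one>\<^bsub>G\<^esub>}} \<rparr>"

lemma Gamma_simple:
  assumes "\<And>H K. H \<in> minimal_subgroups G \<Longrightarrow> K \<in> minimal_subgroups G \<Longrightarrow>
             H <#>\<^bsub>G\<^esub> K = K <#>\<^bsub>G\<^esub> H"
  shows "pair_bidirected_digraph (Gamma G R)"
  by unfold_locales (use assms in \<open>auto simp: Gamma_def symmetric_def sym_def\<close>)

end

theory Submission
  imports Defs "HOL-Algebra.Elementary_Groups"
begin

text \<open>In a \<open>p\<close>-group the minimal subgroups are the subgroups of order \<open>p\<close>. For distinct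
  minimal subgroups \<open>H\<close>, \<open>K\<close> the product \<open>HK\<close> is a subgroup of order \<open>p\<^sup>2\<close> inside \<open>\<Omega>(G)\<close>,
  and \<open>H\<close>, \<open>K\<close> are adjacent in \<open>\<Gamma>(R)\<close> unless \<open>R \<subseteq> HK\<close>. If \<open>\<Omega>(G)\<close> has order \<open>p\<^sup>2\<close>, then
  \<open>HK = \<Omega>(G)\<close> contains \<open>R\<close>. If it is larger, some \<open>x\<close> of order \<open>p\<close> lies outside \<open>HK\<close>, and when
  \<open>R \<subseteq> HK\<close> the subgroup generated by \<open>x\<close> is a common neighbour of \<open>H\<close> and \<open>K\<close>.\<close>

section \<open>Products of subgroups and minimal subgroups in an arbitrary group\<close>

lemma minimal_subgroup_imp_subgroup: "minimal_subgroup H G \<Longrightarrow> subgroup H G"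
  unfolding minimal_subgroup_def by blast

lemma minimal_subgroup_nontrivial: "minimal_subgroup H G \<Longrightarrow> H \<noteq> {\<one>\<^bsub>G\<^esub>}"
  unfolding minimal_subgroup_def by blast

text \<open>Inverting a product reverses its factors, landing in \<open>K <#> H\<close>, and the
  commutation hypothesis turns this back into \<open>H <#> K\<close>. Closure under products is the
  same swap applied to the two middle factors of \<open>HKHK\<close>.\<close>

lemma (in group) set_mult_subgroup:
  assumes H: "subgroup H G" and K: "subgroup K G" and comm: "H <#> K = K <#> H"
  shows "subgroup (H <#> K) G"
proof (rule subgroupI)
  show "H <#> K \<subseteq> carrier G"
    using H K by (simp add: setmult_subset_G subgroup.subset)
  show "H <#> K \<noteq> {}"
    using subgroup.one_closed[OF H] subgroup.one_closed[OF K] by (auto simp: set_mult_def)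
  show "inv a \<in> H <#> K" if "a \<in> H <#> K" for a
  proof -
    obtain h k where "h \<in> H" "k \<in> K" "a = h \<otimes> k"
      using \<open>a \<in> H <#> K\<close> by (auto simp: set_mult_def)
    then have "inv a = inv k \<otimes> inv h" "inv k \<in> K" "inv h \<in> H"
      using H K by (auto simp: inv_mult_group subgroup.mem_carrier subgroup.m_inv_closed)
    then have "inv a \<in> K <#> H" by (auto simp: set_mult_def)
    then show ?thesis using comm by simp
  qed
  show "a \<otimes> b \<in> H <#> K" if "a \<in> H <#> K" "b \<in> H <#> K" for a b
  proof -
    have "a \<otimes> b \<in> (H <#> K) <#> (H <#> K)"
      using that by (auto simp: set_mult_def)
    \<comment> \<open>Associativity isolates the inner factor \<open>K <#> H\<close>, to which
      \<open>comm\<close> applies next.\<close>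
    also have "(H <#> K) <#> (H <#> K) = H <#> ((K <#> H) <#> K)"
      using H K by (simp add: set_mult_assoc setmult_subset_G subgroup.subset)
    also have "\<dots> = (H <#> H) <#> (K <#> K)"
      using H K by (simp add: set_mult_assoc setmult_subset_G subgroup.subset flip: comm)
    also have "\<dots> = H <#> K"
      using H K by (simp add: subgroup_mult_id)
    finally show ?thesis .
  qed
qed

lemma (in group) subset_set_mult:
  assumes "subgroup H G" "subgroup K G"
  shows "H \<subseteq> H <#> K" "K \<subseteq> H <#> K"
proof -
  have "x \<otimes> \<one> \<in> H <#> K" if "x \<in> H" for x
    using that subgroup.one_closed[OF assms(2)] by (auto simp: set_mult_def)
  moreover have "\<one> \<otimes> x \<in> H <#> K" if "x \<in> K" for x
    using that subgroup.one_closed[OF assms(1)] by (auto simp: set_mult_def)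
  ultimately show "H \<subseteq> H <#> K" "K \<subseteq> H <#> K"
    using assms by (auto simp: subgroup.mem_carrier)
qed

text \<open>With trivial intersection, a factorization \<open>h \<otimes> k\<close> determines
  \<open>h\<close> and \<open>k\<close>, so multiplication is a bijection from
  \<open>H \<times> K\<close> onto the product.\<close>

lemma (in group) card_set_mult_disjoint:
  assumes H: "subgroup H G" and K: "subgroup K G" and disj: "H \<inter> K = {\<one>}"
  shows "card (H <#> K) = card H * card K"
proof -
  interpret group_disjoint_sum G H K
    using H K by (simp add: group_disjoint_sum_def is_group)
  have "inj_on (\<lambda>(x, y). x \<otimes> y) (H \<times> K)"
    using cancel disj by (auto simp: inj_on_def)
  moreover have "H <#> K = (\<lambda>(x, y). x \<otimes> y) ` (H \<times> K)"
    by (auto simp: set_mult_def)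
  ultimately show ?thesis
    by (simp add: card_image card_cartesian_product)
qed

text \<open>By Lagrange, the order of a subgroup of \<open>H\<close> is 1 or
  \<open>card H\<close>.\<close>

lemma (in group) minimal_subgroup_if_prime_card:
  assumes H: "subgroup H G" and prime: "prime (card H)"
  shows "minimal_subgroup H G"
  unfolding minimal_subgroup_def
proof (intro conjI allI impI)
  show "H \<noteq> {\<one>}" using prime by auto
  fix K assume K: "subgroup K G \<and> K \<noteq> {\<one>} \<and> K \<subseteq> H"
  \<comment> \<open>An infinite set has \<open>card\<close> equal to 0, which is not prime.\<close>
  have fin: "finite H" using prime by (metis card.infinite not_prime_0)
  have "card K dvd card H"
  proof -
    have "subgroup K (G\<lparr>carrier := H\<rparr>)" using subgroup_incl K H by blast
    from group.lagrange[OF subgroup.subgroup_is_group[OF H is_group] this] show ?thesis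
      by (simp add: order_def) (metis dvd_triv_right)
  qed
  moreover have "card K \<noteq> 1"
    using K subgroup.one_closed[of K G] by (auto simp: card_1_singleton_iff)
  ultimately have "card K = card H"
    using prime by (auto simp: prime_nat_iff)
  then show "K = H" using K fin by (simp add: card_subset_eq)
qed (fact H)

text \<open>The intersection is a subgroup of \<open>H\<close>, so minimality makes it trivial or
  all of \<open>H\<close>.\<close>

lemma (in group) minimal_subgroup_Int:
  assumes "minimal_subgroup H G" "subgroup K G"
  shows "H \<inter> K = {\<one>} \<or> H \<subseteq> K"
  using assms subgroups_Inter_pair[of H K] unfolding minimal_subgroup_def by blast

lemma (in group) distinct_minimal_subgroups_Int:
  assumes "minimal_subgroup H G" "minimal_subgroup K G" "H \<noteq> K"
  shows "H \<inter> K = {\<one>}"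
  using assms minimal_subgroup_Int[of H K] unfolding minimal_subgroup_def by blast

text \<open>The cyclic subgroup of \<open>x\<close> is non-trivial and lies in \<open>H\<close>, so
  minimality forces equality.\<close>

lemma (in group) minimal_subgroup_generate:
  assumes H: "minimal_subgroup H G" and x: "x \<in> H" "x \<noteq> \<one>"
  shows "H = generate G {x}"
proof -
  have sub: "subgroup H G" using H by (rule minimal_subgroup_imp_subgroup)
  then have "subgroup (generate G {x}) G" "generate G {x} \<subseteq> H"
    using x generate_is_subgroup[of "{x}"] generate_subgroup_incl[of "{x}" H]
    by (auto simp: subgroup.mem_carrier)
  moreover have "generate G {x} \<noteq> {\<one>}" using x generate.incl[of x "{x}" G] by auto
  ultimately show ?thesis using H unfolding minimal_subgroup_def by blast
qed

section \<open>Elements of order \<open>p\<close>, minimal subgroups and \<open>Omega\<close> in a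
  \<open>p\<close>-group\<close>

locale prime_power_group = group +
  fixes p :: nat
  assumes prime: "prime p" and p_group: "p_group p G"
begin

text \<open>Any non-trivial element of \<open>H\<close> has a power of order \<open>p\<close>, and
  this power again generates \<open>H\<close>.\<close>

lemma minimal_subgroup_obtains_generator:
  assumes H: "minimal_subgroup H G"
  obtains x where "x \<in> carrier G" "ord x = p" "H = generate G {x}"
proof -
  have sub: "subgroup H G" and "H \<noteq> {\<one>}"
    using H by (simp_all add: minimal_subgroup_imp_subgroup minimal_subgroup_nontrivial)
  then obtain x where x: "x \<in> H" "x \<noteq> \<one>"
    using subgroup.one_closed by fastforce
  then have xG: "x \<in> carrier G" using sub by (simp add: subgroup.mem_carrier)
  then obtain n where n: "ord x = p ^ n" using p_group by (auto simp: p_group_def)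
  have "n \<noteq> 0" using n x ord_eq_1[OF xG] by (metis power_0)
  then obtain m where m: "n = Suc m" using not0_implies_Suc by blast
  \<comment> \<open>Since \<open>x\<close> has order \<open>p ^ Suc m\<close>, raising it to the
    power \<open>p ^ m\<close> leaves order exactly \<open>p\<close>.\<close>
  define y where "y = x [^] (p ^ m)"
  have p0: "p > 0" using prime by (rule prime_gt_0_nat)
  have "ord y = p"
    using ord_pow[OF xG, of "p ^ m"] n m p0 by (simp add: y_def)
  moreover have "y \<in> carrier G" using xG by (simp add: y_def)
  moreover have "y \<in> H"
  proof -
    have "y = x [^] int (p ^ m)"
      unfolding y_def int_pow_int ..
    then have "y \<in> generate G {x}"
      unfolding generate_pow[OF xG] by blast
    then show ?thesis using minimal_subgroup_generate[OF H x] by simp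
  qed
  moreover have "y \<noteq> \<one>" using \<open>ord y = p\<close> prime by auto
  ultimately show thesis using that[of y] minimal_subgroup_generate[OF H, of y] by simp
qed

lemma card_minimal_subgroup:
  assumes "minimal_subgroup H G"
  shows "card H = p"
proof -
  obtain x where "x \<in> carrier G" "ord x = p" "H = generate G {x}"
    using assms by (rule minimal_subgroup_obtains_generator)
  then show ?thesis using generate_pow_card[of x] by simp
qed

text \<open>\<open>H\<close> is generated by an element of order \<open>p\<close>, which is among
  the generators of \<open>Omega p G\<close>.\<close>

lemma minimal_subgroup_subset_Omega:
  assumes "minimal_subgroup H G"
  shows "H \<subseteq> Omega p G"
proof -
  obtain x where x: "x \<in> carrier G" "ord x = p" "H = generate G {x}"
    using assms by (rule minimal_subgroup_obtains_generator)
  then have "x [^] p = \<one>" using pow_ord_eq_1 by metis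
  with x show ?thesis unfolding Omega_def by (simp add: mono_generate)
qed

lemma subgroup_Omega: "subgroup (Omega p G) G"
  unfolding Omega_def by (rule generate_is_subgroup) auto

text \<open>The order of \<open>x\<close> divides the prime \<open>p\<close> and is not 1, so the
  cyclic subgroup has prime order.\<close>

lemma minimal_subgroup_generate_singleton:
  assumes "x \<in> carrier G" "x [^] p = \<one>" "x \<noteq> \<one>"
  shows "minimal_subgroup (generate G {x}) G"
proof (rule minimal_subgroup_if_prime_card)
  show "subgroup (generate G {x}) G" using assms by (simp add: generate_is_subgroup)
  have "ord x dvd p" "ord x \<noteq> 1" using assms ord_eq_1[of x] by (auto simp: pow_eq_id)
  then have "ord x = p" using prime by (auto simp: prime_nat_iff)
  then show "prime (card (generate G {x}))"
    using assms prime by (simp add: generate_pow_card)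
qed

lemma card_set_mult_minimal_subgroups:
  assumes "minimal_subgroup H G" "minimal_subgroup K G" "H \<noteq> K"
  shows "card (H <#> K) = p\<^sup>2"
proof -
  have "subgroup H G" "subgroup K G" using assms by (simp_all add: minimal_subgroup_imp_subgroup)
  then show ?thesis
    using card_set_mult_disjoint distinct_minimal_subgroups_Int[OF assms]
      assms(1,2)[THEN card_minimal_subgroup]
    by (simp add: power2_eq_square)
qed

text \<open>\<open>S\<close> is too small to contain \<open>Omega p G\<close>, so it misses one of
  the generators. The minimal subgroup spanned by that generator is not contained in
  \<open>S\<close>, hence meets it trivially.\<close>

lemma minimal_subgroup_outside:
  assumes S: "subgroup S G" "finite S" and large: "infinite (Omega p G) \<or> card (Omega p G) > card S"
  obtains L where "minimal_subgroup L G" "L \<inter> S = {\<one>}"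
proof -
  have "\<not> Omega p G \<subseteq> S"
    using S large by (meson card_mono finite_subset linorder_not_le)
  then have "\<not> {x \<in> carrier G. x [^] p = \<one>} \<subseteq> S"
    using S generate_subgroup_incl unfolding Omega_def by blast
  then obtain x where x: "x \<in> carrier G" "x [^] p = \<one>" "x \<notin> S" by blast
  moreover have "x \<noteq> \<one>" using x S subgroup.one_closed by blast
  ultimately have L: "minimal_subgroup (generate G {x}) G"
    by (simp add: minimal_subgroup_generate_singleton)
  moreover have "\<not> generate G {x} \<subseteq> S"
    using x generate.incl[of x "{x}" G] by blast
  ultimately show thesis
    using that minimal_subgroup_Int S by blast
qed

end

section \<open>Edges and connectedness of the graph\<close>

lemma (in group) set_mult_Int_trivial:
  assumes H: "subgroup H G" and L: "subgroup L G" and S: "subgroup S G"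
    and R: "subgroup R G" and "H \<subseteq> S" "R \<subseteq> S" "L \<inter> S = {\<one>}" "H \<inter> R = {\<one>}"
  shows "(H <#> L) \<inter> R = {\<one>}"
proof
  show "{\<one>} \<subseteq> (H <#> L) \<inter> R"
    using subset_set_mult[OF H L] subgroup.one_closed[OF H] subgroup.one_closed[OF R]
    by blast
  show "(H <#> L) \<inter> R \<subseteq> {\<one>}"
  proof
    fix x assume x: "x \<in> (H <#> L) \<inter> R"
    then obtain h l where hl: "h \<in> H" "l \<in> L" "x = h \<otimes> l"
      by (auto simp: set_mult_def)
    have hG: "h \<in> carrier G" and lG: "l \<in> carrier G"
      using hl H L by (auto simp: subgroup.mem_carrier)
    \<comment> \<open>Both \<open>h\<close> and \<open>x\<close> lie in \<open>S\<close>, so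
      \<open>l\<close> lies in \<open>L \<inter> S\<close> and is trivial. This leaves
      \<open>x = h\<close>, an element of \<open>H \<inter> R\<close>.\<close>
    have "inv h \<otimes> x \<in> S"
      using x hl(1) \<open>H \<subseteq> S\<close> \<open>R \<subseteq> S\<close>
      by (intro subgroup.m_closed[OF S] subgroup.m_inv_closed[OF S]) auto
    moreover have "inv h \<otimes> x = l" using hl hG lG by (simp add: inv_solve_left')
    ultimately have "l = \<one>" using hl(2) \<open>L \<inter> S = {\<one>}\<close> by blast
    then have "x \<in> H \<inter> R" using hl hG x by simp
    then show "x \<in> {\<one>}" using \<open>H \<inter> R = {\<one>}\<close> by simp
  qed
qed

theorem theorem3p11:
  fixes p :: nat and G :: "('a, 'b) monoid_scheme" and H\<^sub>r :: "'a set"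
  assumes "prime p"
    and "p_group p G"
    and "carrier G \<noteq> {\<one>\<^bsub>G\<^esub>}"
    and "\<And>H\<^sub>i H\<^sub>j. H\<^sub>i \<in> minimal_subgroups G \<Longrightarrow> H\<^sub>j \<in> minimal_subgroups G \<Longrightarrow>
           H\<^sub>i <#>\<^bsub>G\<^esub> H\<^sub>j = H\<^sub>j <#>\<^bsub>G\<^esub> H\<^sub>i"
    and "infinite (minimal_subgroups G) \<or> card (minimal_subgroups G) \<ge> 2"
    and "H\<^sub>r \<in> minimal_subgroups G"
  shows "(card (Omega p G) = p\<^sup>2 \<longrightarrow> parcs (Gamma G H\<^sub>r) = {}) \<and>
         (infinite (Omega p G) \<or> card (Omega p G) > p\<^sup>2 \<longrightarrow>
            Digraph_Component.connected (with_proj (Gamma G H\<^sub>r)))"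
proof -
  interpret prime_power_group G p
    using assms(1,2) by (simp add: prime_power_group_def prime_power_group_axioms_def p_group_def)
  have R: "minimal_subgroup H\<^sub>r G" using assms(6) by (simp add: minimal_subgroups_def)
  have sub: "subgroup H G" if "minimal_subgroup H G" for H
    using that by (rule minimal_subgroup_imp_subgroup)
  \<comment> \<open>The commutation hypothesis enters here: it makes \<open>HK\<close> a subgroup,
    to which the dichotomy for intersections with \<open>H\<^sub>r\<close> applies.\<close>
  have prod_sub: "subgroup (H <#>\<^bsub>G\<^esub> K) G" if "minimal_subgroup H G" "minimal_subgroup K G" for H K
    using that assms(4)[of H K] by (simp add: set_mult_subgroup sub minimal_subgroups_def)
  have prod_Omega: "H <#>\<^bsub>G\<^esub> K \<subseteq> Omega p G" if "minimal_subgroup H G" "minimal_subgroup K G" for H K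
    using mono_set_mult[OF that[THEN minimal_subgroup_subset_Omega], of G]
    by (simp add: subgroup_mult_id subgroup_Omega)
  have no_arcs: "parcs (Gamma G H\<^sub>r) = {}" if card: "card (Omega p G) = p\<^sup>2"
  proof -
    have "(H <#>\<^bsub>G\<^esub> K) \<inter> H\<^sub>r \<noteq> {\<one>\<^bsub>G\<^esub>}"
      if H: "minimal_subgroup H G" and K: "minimal_subgroup K G" and "H \<noteq> K" for H K
    proof -
      \<comment> \<open>The order \<open>p\<^sup>2\<close> is not 0, the value of
        \<open>card\<close> on infinite sets. Finiteness then lets equal cardinalities turn the
        inclusion of \<open>HK\<close> into an equality.\<close>
      have "finite (Omega p G)"
        using card prime by (metis card.infinite not_prime_0 power_not_zero)
      then have "H <#>\<^bsub>G\<^esub> K = Omega p G"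
        using prod_Omega[OF H K] card card_set_mult_minimal_subgroups[OF H K \<open>H \<noteq> K\<close>]
        by (simp add: card_subset_eq)
      then have "(H <#>\<^bsub>G\<^esub> K) \<inter> H\<^sub>r = H\<^sub>r"
        using minimal_subgroup_subset_Omega[OF R] by auto
      then show ?thesis using minimal_subgroup_nontrivial[OF R] by simp
    qed
    then show ?thesis by (auto simp: Gamma_def minimal_subgroups_def)
  qed
  have connected: "Digraph_Component.connected (with_proj (Gamma G H\<^sub>r))"
    if large: "infinite (Omega p G) \<or> card (Omega p G) > p\<^sup>2"
  proof -
    interpret pair_bidirected_digraph "Gamma G H\<^sub>r"
      using assms(4) by (rule Gamma_simple)
    have wf: "wf_digraph (with_proj (Gamma G H\<^sub>r))"
      by unfold_locales
    have verts: "pverts (Gamma G H\<^sub>r) = minimal_subgroups G - {H\<^sub>r}"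
      by (simp add: Gamma_def)
    have arc_iff: "H \<rightarrow>\<^bsub>with_proj (Gamma G H\<^sub>r)\<^esub> K \<longleftrightarrow> minimal_subgroup H G \<and> minimal_subgroup K G \<and>
        H \<noteq> H\<^sub>r \<and> K \<noteq> H\<^sub>r \<and> H \<noteq> K \<and> (H <#>\<^bsub>G\<^esub> K) \<inter> H\<^sub>r = {\<one>\<^bsub>G\<^esub>}" for H K
      by (auto simp: Gamma_def minimal_subgroups_def)
    have "H \<rightarrow>\<^sup>*\<^bsub>with_proj (Gamma G H\<^sub>r)\<^esub> K"
      if H: "minimal_subgroup H G" "H \<noteq> H\<^sub>r" and K: "minimal_subgroup K G" "K \<noteq> H\<^sub>r" for H K
    proof (cases "H = K \<or> (H <#>\<^bsub>G\<^esub> K) \<inter> H\<^sub>r = {\<one>\<^bsub>G\<^esub>}")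
      case True
      have "H \<in> pverts (Gamma G H\<^sub>r)"
        using H by (simp add: verts minimal_subgroups_def)
      moreover have "H = K \<or> H \<rightarrow>\<^bsub>with_proj (Gamma G H\<^sub>r)\<^esub> K"
        using True H K unfolding arc_iff by blast
      ultimately show ?thesis
        using reachable_refl[of H] by auto
    next
      case False
      \<comment> \<open>\<open>H\<close> and \<open>K\<close> are distinct and not adjacent, so
        \<open>HK\<close> meets \<open>H\<^sub>r\<close> non-trivially and by minimality contains
        it.\<close>
      then have "H \<noteq> K" and RS: "H\<^sub>r \<subseteq> H <#>\<^bsub>G\<^esub> K"
        using minimal_subgroup_Int[OF R prod_sub[OF H(1) K(1)]] by (auto simp: Int_commute)
      then have cardS: "card (H <#>\<^bsub>G\<^esub> K) = p\<^sup>2"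
        using card_set_mult_minimal_subgroups H K by blast
      then have "finite (H <#>\<^bsub>G\<^esub> K)"
        using prime by (metis card.infinite not_prime_0 power_not_zero)
      then obtain L where L: "minimal_subgroup L G" "L \<inter> (H <#>\<^bsub>G\<^esub> K) = {\<one>\<^bsub>G\<^esub>}"
        using minimal_subgroup_outside prod_sub[OF H(1) K(1)] cardS large by metis
      have HS: "H \<subseteq> H <#>\<^bsub>G\<^esub> K" and KS: "K \<subseteq> H <#>\<^bsub>G\<^esub> K"
        using subset_set_mult[OF sub[OF H(1)] sub[OF K(1)]] by simp_all
      \<comment> \<open>A subgroup of \<open>HK\<close> equal to \<open>L\<close> would lie in
        \<open>L \<inter> HK\<close>, which is trivial.\<close>
      have ne: "M \<noteq> L" if "M \<subseteq> H <#>\<^bsub>G\<^esub> K" "minimal_subgroup M G" for M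
        using that L minimal_subgroup_nontrivial[of M G] by blast
      \<comment> \<open>Stated for a general \<open>M\<close> inside \<open>HK\<close> because it is
        used for both \<open>H\<close> and \<open>K\<close>. The disjointness lemma is applied with
        \<open>S\<close> taken as \<open>HK\<close>.\<close>
      have arc: "M \<rightarrow>\<^bsub>with_proj (Gamma G H\<^sub>r)\<^esub> L"
        if M: "minimal_subgroup M G" "M \<noteq> H\<^sub>r" "M \<subseteq> H <#>\<^bsub>G\<^esub> K" for M
        unfolding arc_iff
      proof (intro conjI)
        show "(M <#>\<^bsub>G\<^esub> L) \<inter> H\<^sub>r = {\<one>\<^bsub>G\<^esub>}"
          using sub[OF M(1)] sub[OF L(1)] prod_sub[OF H(1) K(1)] sub[OF R] M(3) RS L(2)
            distinct_minimal_subgroups_Int[OF M(1) R M(2)]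
          by (rule set_mult_Int_trivial)
      qed (use M L ne[OF M(3,1)] ne[OF RS R] in simp_all)
      \<comment> \<open>The arc from \<open>K\<close> to \<open>L\<close> is reversed by
        commutation, giving the path from \<open>H\<close> through \<open>L\<close> to
        \<open>K\<close>.\<close>
      have "L \<rightarrow>\<^bsub>with_proj (Gamma G H\<^sub>r)\<^esub> K"
        using arc[OF K KS] assms(4)[of L K] L(1) K(1) unfolding arc_iff minimal_subgroups_def by auto
      with arc[OF H HS] show ?thesis
        by (rule wf_digraph.adj_reachable_trans[OF wf _ wf_digraph.reachable_adjI[OF wf]])
    qed
    \<comment> \<open>Connectedness in the graph library includes having a vertex; the existence of
      at least two minimal subgroups supplies one.\<close>
    moreover have "minimal_subgroups G - {H\<^sub>r} \<noteq> {}"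
    proof
      assume "minimal_subgroups G - {H\<^sub>r} = {}"
      then have "minimal_subgroups G = {H\<^sub>r}" using assms(6) by auto
      then show False using assms(5) by simp
    qed
    ultimately show ?thesis
      unfolding connected_def strongly_connected_def
      by (auto intro!: wf_digraph.reachable_mk_symmetricI[OF wf] simp: verts minimal_subgroups_def)
  qed
  show ?thesis using no_arcs connected by blast
qed

end
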